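(* Let $n\ge 1$ be an integer, let $\mathbb{F}\in\{\mathbb{R},\mathbb{C}\}$, and let $V$ be an $n$-dimensional linear space over $\mathbb{F}$ equipped with a scalar product $\langle\cdot,\cdot\rangle:V\times V\to\mathbb{F}$. For any norm $f:V\to\mathbb{R}^+$, any $f$-minimal basis $(b_1,b_2,\dots,b_n)$ of $V$, and every $v\in V$, $$(2^n-1)\,f(v)\ \ge\ \sum_{i=1}^n |\langle v,b_i\rangle|\, f(b_i).$$
   Context: $\mathbb{R}^+$ denotes the non-negative reals. $\mathbb{S}_1=\{u\in V: \langle u,u\rangle=1\}$ is the unit sphere of the scalar product; the norm $f$ is arbitrary and need not be related to the scalar product. An $f$-minimal basis is an (ordered, orthonormal) basis of $V$ defined inductively on $n=\dim V$. If $n=1$, then $(b)$ is $f$-minimal for any $b\in\mathbb{S}_1$. If $n>1$, choose $b_1\in\arg\min\{f(b): b\in\mathbb{S}_1\}$, let $V_1=\{u\in V:\langle u,b_1\rangle=0\}$ and let $f_1=f\upharpoonright V_1$ be the restriction of $f$ to $V_1$; if $(b_2,\dots,b_n)$ is an $f_1$-minimal basis of $V_1$, then $(b_1,b_2,\dots,b_n)$ is an $f$-minimal basis of $V$. *)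

theory Defs
  imports "HOL-Analysis.Analysis" "Jordan_Normal_Form.Conjugate"
begin

text \<open>
  The scalar field is kept polymorphic so that \<^typ>\<open>real\<close> and \<^typ>\<open>complex\<close> are treated
  uniformly: \<^const>\<open>conjugate\<close> is the identity on the reals and \<^const>\<open>cnj\<close> on the complex
  numbers. On the complex numbers \<open>0 < z\<close> means that \<open>z\<close> is real and positive.
\<close>

locale scalar_product_space = vector_space scale
  for scale :: "'f::{real_normed_field, conjugatable_ordered_field} \<Rightarrow> 'v::ab_group_add \<Rightarrow> 'v"
      (infixr \<open>*s\<close> 75) +
  fixes sprod :: "'v \<Rightarrow> 'v \<Rightarrow> 'f"
  assumes sprod_add_left: "sprod (x + y) z = sprod x z + sprod y z"
    and sprod_scale_left: "sprod (c *s x) z = c * sprod x z"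
    and sprod_conjugate: "sprod y x = conjugate (sprod x y)"
    and sprod_pos: "x \<noteq> 0 \<Longrightarrow> 0 < sprod x x"

locale norm_on_space = vector_space scale
  for scale :: "'f::real_normed_field \<Rightarrow> 'v::ab_group_add \<Rightarrow> 'v" (infixr \<open>*s\<close> 75) +
  fixes f :: "'v \<Rightarrow> real"
  assumes nonneg: "0 \<le> f x"
    and eq_zero_iff: "f x = 0 \<longleftrightarrow> x = 0"
    and homogeneous: "f (c *s x) = norm c * f x"
    and triangle: "f (x + y) \<le> f x + f y"

context scalar_product_space
begin

definition unit_sphere :: "'v set" where
  "unit_sphere = {u. sprod u u = 1}"

text \<open>
  \<open>minimal_basis f W bs\<close>: the list \<open>bs\<close> is a minimal basis, with respect to the restriction of
  \<open>f\<close> to \<open>W\<close>, of the finite-dimensional subspace \<open>W\<close>. The recursion passes to subspaces, so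
  \<open>f\<close> stays total and only its values on \<open>W\<close> are used.
  Since \<^const>\<open>dim\<close> is 0 for infinite-dimensional spaces, \<open>dim W \<ge> 1\<close> forces \<open>W\<close> to be
  finite-dimensional.
\<close>

inductive minimal_basis :: "('v \<Rightarrow> real) \<Rightarrow> 'v set \<Rightarrow> 'v list \<Rightarrow> bool"
  for f :: "'v \<Rightarrow> real" where
  singleton: "subspace W \<Longrightarrow> dim W = 1 \<Longrightarrow> b \<in> W \<inter> unit_sphere \<Longrightarrow> minimal_basis f W [b]"
| step: "subspace W \<Longrightarrow> dim W > 1 \<Longrightarrow> is_arg_min f (\<lambda>b. b \<in> W \<inter> unit_sphere) b \<Longrightarrow>
    minimal_basis f {u \<in> W. sprod u b = 0} bs \<Longrightarrow> minimal_basis f W (b # bs)"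

end

end

theory Submission
  imports Defs
begin

text \<open>
  Induction along the recursive definition of a minimal basis. With \<open>b\<close> the first basis vector and
  \<open>w = v - \<langle>v,b\<rangle> b\<close>, minimality of \<open>f b\<close> on the unit sphere and \<open>|\<langle>v,b\<rangle>| \<le> \<parallel>v\<parallel>\<close> give
  \<open>|\<langle>v,b\<rangle>| f b \<le> f v\<close>, hence \<open>f w \<le> 2 f v\<close>. The remaining coefficients of \<open>v\<close> are those of \<open>w\<close>,
  so the constant obeys \<open>c\<^sub>n = 1 + 2 c\<^sub>n\<^sub>-\<^sub>1\<close> with \<open>c\<^sub>1 = 1\<close>.
\<close>

text \<open>The last two assumptions link norm, conjugation and order; the type classes alone do not.\<close>

locale normed_scalar_product_space = scalar_product_space scale sprod + norm_on_space scale f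
  for scale :: "'f::{real_normed_field, conjugatable_ordered_field} \<Rightarrow> 'v::ab_group_add \<Rightarrow> 'v"
      (infixr \<open>*s\<close> 75)
    and sprod :: "'v \<Rightarrow> 'v \<Rightarrow> 'f"
    and f :: "'v \<Rightarrow> real" +
  assumes mult_conjugate: "\<And>c::'f. c * conjugate c = of_real ((norm c)\<^sup>2)"
    and pos_eq_norm: "\<And>c::'f. 0 < c \<Longrightarrow> c = of_real (norm c)"
begin

text \<open>Cancel \<open>of_real a\<close> in \<open>mult_conjugate\<close>; this fixes the
  otherwise abstract \<open>conjugate\<close> on the embedded reals.\<close>

lemma conjugate_of_real: "conjugate (of_real a :: 'f) = of_real a"
proof (cases "a = 0")
  case False
  have "of_real a * conjugate (of_real a) = (of_real a * of_real a :: 'f)"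
    using mult_conjugate[of "of_real a"] by (simp add: power2_eq_square flip: of_real_mult)
  with False show ?thesis by simp
qed simp

lemma sprod_zero_left: "sprod 0 x = 0"
  using sprod_add_left[of 0 0 x] by simp

lemma sprod_add_right: "sprod x (y + z) = sprod x y + sprod x z"
  by (simp add: sprod_conjugate[of x] sprod_add_left conjugate_dist_add)

lemma sprod_scale_right: "sprod x (c *s y) = conjugate c * sprod x y"
  by (simp add: sprod_conjugate[of x] sprod_scale_left conjugate_dist_mul)

lemma sprod_diff_left: "sprod (x - y) z = sprod x z - sprod y z"
  using sprod_add_left[of "x - y" y z] by simp

lemma sprod_self: "sprod x x = of_real (norm (sprod x x))"
  by (cases "x = 0") (auto simp: sprod_zero_left sprod_pos intro: pos_eq_norm)

lemma sprod_residual: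
  assumes "b \<in> unit_sphere"
  shows "sprod (v - sprod v b *s b) b = 0"
  using assms by (simp add: unit_sphere_def sprod_diff_left sprod_scale_left)

lemma subspace_orthogonal:
  assumes "subspace W"
  shows "subspace {u \<in> W. sprod u b = 0}"
  using assms by (auto simp: subspace_def sprod_zero_left sprod_add_left sprod_scale_left)

lemma residual_in_orthogonal:
  assumes "subspace W" "b \<in> W" "b \<in> unit_sphere" "v \<in> W"
  shows "v - sprod v b *s b \<in> {u \<in> W. sprod u b = 0}"
  using assms sprod_residual by (auto intro: subspace_diff subspace_scale)

text \<open>A basis \<open>B\<close> of the orthogonal complement of \<open>b\<close> in
  \<open>W\<close> becomes a basis of \<open>W\<close> once \<open>b\<close> is added:
  \<open>b\<close> is not orthogonal to itself, so it lies outside \<open>span B\<close>, and every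
  vector of \<open>W\<close> is a multiple of \<open>b\<close> plus its residual.\<close>

lemma dim_eq_Suc_orthogonal:
  assumes W: "subspace W" "0 < dim W" and b: "b \<in> W" "b \<in> unit_sphere"
  shows "dim W = Suc (dim {u \<in> W. sprod u b = 0})"
proof -
  let ?U = "{u \<in> W. sprod u b = 0}"
  obtain B where B: "B \<subseteq> ?U" "independent B" "?U \<subseteq> span B" "card B = dim ?U"
    by (rule basis_exists)
  have U: "span B \<subseteq> ?U"
    using B(1) W(1) by (intro span_minimal subspace_orthogonal)
  have "sprod b b \<noteq> 0"
    using b(2) by (simp add: unit_sphere_def)
  then have nin: "b \<notin> span B"
    using U by auto
  have ind: "independent (insert b B)"
    using nin B(2) by (simp add: independent_insertI)
  have "W \<subseteq> span (insert b B)"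
  proof
    fix v assume "v \<in> W"
    then have "v - sprod v b *s b \<in> span B"
      using residual_in_orthogonal[OF W(1) b] B(3) by blast
    then show "v \<in> span (insert b B)"
      by (auto simp: span_insert)
  qed
  moreover have "insert b B \<subseteq> W"
    using B(1) b(1) by blast
  ultimately have dim: "dim W = card (insert b B)"
    using ind by (metis basis_card_eq_dim)
  \<comment> \<open>An infinite basis would have \<open>card\<close> 0, contradicting
    \<open>0 < dim W\<close>.\<close>
  then have "finite (insert b B)"
    using W(2) by (metis card.infinite less_irrefl)
  moreover have "b \<notin> B"
    using nin span_base by blast
  ultimately show ?thesis
    using B(4) dim by simp
qed

text \<open>Turns the exponent \<open>length bs\<close> of the inductive bound into the dimension
  \<open>n\<close>.\<close>

lemma length_minimal_basis:
  "minimal_basis f W bs \<Longrightarrow> length bs = dim W"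
proof (induction rule: minimal_basis.induct)
  case (step W b bs)
  then have "dim W = Suc (dim {u \<in> W. sprod u b = 0})"
    by (intro dim_eq_Suc_orthogonal) (simp_all add: is_arg_min_def)
  with step.IH show ?case
    by (simp only: list.size)
qed simp

lemma minimal_basis_subset:
  "minimal_basis f W bs \<Longrightarrow> set bs \<subseteq> W"
  by (induction rule: minimal_basis.induct) (auto simp: is_arg_min_def)

text \<open>Pythagoras for the orthogonal splitting of \<open>v\<close> into its component along
  \<open>b\<close> and the residual.\<close>

lemma norm_sprod_self_decomp:
  assumes "b \<in> unit_sphere"
  shows "norm (sprod v v) =
    (norm (sprod v b))\<^sup>2 + norm (sprod (v - sprod v b *s b) (v - sprod v b *s b))"
proof -
  define c w where "c = sprod v b" and "w = v - c *s b"
  have v: "v = c *s b + w"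
    by (simp add: w_def)
  have wb: "sprod w b = 0"
    using sprod_residual[OF assms] by (simp add: w_def c_def)
  then have bw: "sprod b w = 0"
    by (simp add: sprod_conjugate[of b w])
  have "of_real (norm (sprod v v)) = sprod v v"
    by (rule sprod_self[symmetric])
  also have "\<dots> = c * conjugate c + sprod w w"
    using assms unfolding v
    by (simp add: sprod_add_left sprod_add_right sprod_scale_left sprod_scale_right
        wb bw unit_sphere_def)
  also have "\<dots> = of_real ((norm c)\<^sup>2) + of_real (norm (sprod w w))"
    by (rule arg_cong2[where f = "(+)", OF mult_conjugate sprod_self])
  also have "\<dots> = of_real ((norm c)\<^sup>2 + norm (sprod w w))"
    by (rule of_real_add[symmetric])
  finally show ?thesis
    by (simp only: of_real_eq_iff c_def w_def)
qed

text \<open>Rescaling \<open>v\<close> to the unit sphere and comparing with the minimizer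
  \<open>b\<close> gives \<open>r * f b \<le> f v\<close>, where \<open>r\<close> is the length of
  \<open>v\<close> in the scalar product; and \<open>r\<close> bounds the coefficient of
  \<open>v\<close> along \<open>b\<close>.\<close>

lemma norm_sprod_mult_le:
  assumes W: "subspace W" and v: "v \<in> W"
    and b: "is_arg_min f (\<lambda>b. b \<in> W \<inter> unit_sphere) b"
  shows "norm (sprod v b) * f b \<le> f v"
proof (cases "v = 0")
  case False
  define r where "r = sqrt (norm (sprod v v))"
  have bu: "b \<in> unit_sphere"
    using b by (simp add: is_arg_min_def)
  have "sprod v v \<noteq> 0"
    using sprod_pos[OF False] by auto
  then have r: "r > 0" and "r\<^sup>2 = norm (sprod v v)"
    by (simp_all add: r_def)
  then have r2: "sprod v v = of_real (r\<^sup>2)"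
    by (simp only: flip: sprod_self)
  define u where "u = of_real (1 / r) *s v"
  have "sprod u u = of_real (1 / r) * of_real (1 / r) * of_real (r\<^sup>2)"
    by (simp only: u_def sprod_scale_left sprod_scale_right conjugate_of_real r2 mult.assoc)
  also have "\<dots> = of_real (1 / r * (1 / r) * r\<^sup>2)"
    by (simp only: of_real_mult)
  also have "\<dots> = 1"
    using r by (simp add: power2_eq_square)
  finally have "u \<in> W \<inter> unit_sphere"
    using W v by (simp add: unit_sphere_def u_def subspace_scale)
  then have "f b \<le> f u"
    using b by (auto simp: is_arg_min_def not_less)
  also have "f u = f v / r"
    using r by (simp add: u_def homogeneous norm_divide)
  finally have *: "r * f b \<le> f v"
    using r by (simp add: field_simps)
  \<comment> \<open>Drop the nonnegative residual term from Pythagoras.\<close>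
  have "norm (sprod v b) \<le> r"
    unfolding r_def by (rule real_le_rsqrt) (simp add: norm_sprod_self_decomp[OF bu, of v])
  then have "norm (sprod v b) * f b \<le> r * f b"
    by (intro mult_right_mono nonneg)
  with * show ?thesis
    by simp
qed (simp add: sprod_zero_left nonneg)

text \<open>Stated for subspaces \<open>W\<close> and all \<open>v\<close> in them, so that the
  induction hypothesis applies to the residual of \<open>v\<close> in the orthogonal complement of
  the first basis vector.\<close>

theorem minimal_basis_sum_le:
  assumes "minimal_basis f W bs" "v \<in> W"
  shows "(\<Sum>i<length bs. norm (sprod v (bs ! i)) * f (bs ! i)) \<le> (2 ^ length bs - 1) * f v"
  using assms
proof (induction arbitrary: v rule: minimal_basis.induct)
  case (singleton W b)
  then have b: "b \<in> W" "b \<in> unit_sphere"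
    by auto
  \<comment> \<open>In dimension one \<open>v\<close> is a multiple of \<open>b\<close>, and the
    bound is an equality.\<close>
  obtain B where B: "B \<subseteq> W" "W \<subseteq> span B" "card B = dim W"
    by (rule basis_exists)
  then have "card B = 1"
    using singleton.hyps(2) by simp
  then obtain x where "B = {x}"
    by (rule card_1_singletonE)
  then have "W \<subseteq> range (\<lambda>k. k *s x)"
    using B(2) by (simp only: span_singleton)
  then obtain k l where k: "b = k *s x" and l: "v = l *s x"
    using b(1) singleton.prems by blast
  have "k \<noteq> 0"
    using k b(2) by (auto simp: unit_sphere_def sprod_zero_left)
  then have v: "v = (l / k) *s b"
    by (simp add: k l)
  then have "sprod v b = l / k"
    using b(2) by (simp add: unit_sphere_def sprod_scale_left)
  then have "f v = norm (sprod v b) * f b"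
    using homogeneous[of "l / k" b] v by simp
  then show ?case
    by simp
next
  case (step W b bs)
  define w where "w = v - sprod v b *s b"
  have b: "b \<in> W" "b \<in> unit_sphere"
    using step.hyps by (auto simp: is_arg_min_def)
  have w: "w \<in> {u \<in> W. sprod u b = 0}"
    unfolding w_def using step.hyps(1) b step.prems by (rule residual_in_orthogonal)
  have le: "norm (sprod v b) * f b \<le> f v"
    using step.hyps(1) step.prems step.hyps(3) by (rule norm_sprod_mult_le)
  have "f w \<le> f v + f (- sprod v b *s b)"
    using triangle[of v "- sprod v b *s b"] by (simp add: w_def)
  also have "\<dots> = f v + norm (sprod v b) * f b"
    by (simp only: homogeneous norm_minus_cancel)
  also have "\<dots> \<le> 2 * f v"
    using le by simp
  finally have fw: "f w \<le> 2 * f v" .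
  \<comment> \<open>The later basis vectors are orthogonal to \<open>b\<close>, so removing the
    \<open>b\<close>-component of \<open>v\<close> leaves their coefficients unchanged.\<close>
  have coeff: "sprod v (bs ! i) = sprod w (bs ! i)" if "i < length bs" for i
  proof -
    have "sprod (bs ! i) b = 0"
      using minimal_basis_subset[OF step.hyps(4)] nth_mem[OF that] by blast
    then have "sprod b (bs ! i) = 0"
      by (simp add: sprod_conjugate[of b])
    then show ?thesis
      by (simp add: w_def sprod_diff_left sprod_scale_left)
  qed
  have "(\<Sum>i<length (b # bs). norm (sprod v ((b # bs) ! i)) * f ((b # bs) ! i))
      = norm (sprod v b) * f b + (\<Sum>i<length bs. norm (sprod w (bs ! i)) * f (bs ! i))"
    by (simp add: sum.lessThan_Suc_shift coeff del: sum.lessThan_Suc)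
  also have "\<dots> \<le> f v + (2 ^ length bs - 1) * f w"
    using le step.IH[OF w] by simp
  also have "\<dots> \<le> f v + (2 ^ length bs - 1) * (2 * f v)"
    using fw by (intro add_left_mono mult_left_mono) auto
  \<comment> \<open>With \<open>k = length bs\<close>, this is
    \<open>1 + 2 * (2 ^ k - 1) = 2 ^ (k + 1) - 1\<close>.\<close>
  also have "\<dots> = (2 ^ length (b # bs) - 1) * f v"
    by (simp add: algebra_simps)
  finally show ?case .
qed

end

theorem theorem4:
  fixes n :: nat
  assumes "n \<ge> 1"
  shows
    "(\<forall>(scale :: real \<Rightarrow> 'v::ab_group_add \<Rightarrow> 'v) (sprod :: 'v \<Rightarrow> 'v \<Rightarrow> real) f bs v.
        scalar_product_space scale sprod \<longrightarrow>
        vector_space.dim scale (UNIV :: 'v set) = n \<longrightarrow>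
        norm_on_space scale f \<longrightarrow>
        scalar_product_space.minimal_basis scale sprod f UNIV bs \<longrightarrow>
        (2 ^ n - 1) * f v \<ge> (\<Sum>i<n. norm (sprod v (bs ! i)) * f (bs ! i)))
     \<and>
     (\<forall>(scale :: complex \<Rightarrow> 'w::ab_group_add \<Rightarrow> 'w) (sprod :: 'w \<Rightarrow> 'w \<Rightarrow> complex) f bs v.
        scalar_product_space scale sprod \<longrightarrow>
        vector_space.dim scale (UNIV :: 'w set) = n \<longrightarrow>
        norm_on_space scale f \<longrightarrow>
        scalar_product_space.minimal_basis scale sprod f UNIV bs \<longrightarrow>
        (2 ^ n - 1) * f v \<ge> (\<Sum>i<n. norm (sprod v (bs ! i)) * f (bs ! i)))"
proof (intro conjI allI impI)
  fix scale :: "real \<Rightarrow> 'v \<Rightarrow> 'v" and sprod :: "'v \<Rightarrow> 'v \<Rightarrow> real" and f bs v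
  assume S: "scalar_product_space scale sprod" "norm_on_space scale f"
    and d: "vector_space.dim scale (UNIV :: 'v set) = n"
    and m: "scalar_product_space.minimal_basis scale sprod f UNIV bs"
  interpret normed_scalar_product_space scale sprod f
    by (intro normed_scalar_product_space.intro S normed_scalar_product_space_axioms.intro)
      (simp_all add: power2_eq_square)
  show "(2 ^ n - 1) * f v \<ge> (\<Sum>i<n. norm (sprod v (bs ! i)) * f (bs ! i))"
    using minimal_basis_sum_le[OF m UNIV_I] length_minimal_basis[OF m] d by simp
next
  fix scale :: "complex \<Rightarrow> 'w \<Rightarrow> 'w" and sprod :: "'w \<Rightarrow> 'w \<Rightarrow> complex" and f bs v
  assume S: "scalar_product_space scale sprod" "norm_on_space scale f"
    and d: "vector_space.dim scale (UNIV :: 'w set) = n"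
    and m: "scalar_product_space.minimal_basis scale sprod f UNIV bs"
  \<comment> \<open>Over the complex numbers, \<open>0 < c\<close> forces a zero imaginary part and
    a positive real part, so \<open>c\<close> equals its modulus; \<open>c * cnj c\<close> is the
    squared modulus.\<close>
  interpret normed_scalar_product_space scale sprod f
    by (intro normed_scalar_product_space.intro S normed_scalar_product_space_axioms.intro)
      (simp_all add: less_complex_def complex_eq_iff cmod_def flip: complex_norm_square)
  show "(2 ^ n - 1) * f v \<ge> (\<Sum>i<n. norm (sprod v (bs ! i)) * f (bs ! i))"
    using minimal_basis_sum_le[OF m UNIV_I] length_minimal_basis[OF m] d by simp
qed

end
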